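(* Let $\sigma=(v_1,\dots,v_n)$ be an order of $[n]$ and let $D\subseteq H$ be two undirected graphs on the vertex set $[n]$. Then the fixed order characteristic imset polytope, i.e. the convex hull of the characteristic imsets $c_{\mathcal{G}}$ of all directed acyclic graphs $\mathcal{G}$ on $[n]$ that respect $\sigma$ and whose skeleton $G$ satisfies $D\subseteq G\subseteq H$, fulfills the rhombus criterion.
   Context: $[n]=\{1,\dots,n\}$. For a directed acyclic graph (DAG) $\mathcal{G}$ on $[n]$, $\operatorname{pa}_{\mathcal{G}}(i)$ is the set of $j$ such that $j\to i$ is an arc of $\mathcal{G}$, and the characteristic imset $c_{\mathcal{G}}\in\mathbb{R}^{\{S\subseteq[n]:|S|\ge2\}}$ is defined by $c_{\mathcal{G}}(S)=1$ if there exists $i\in S$ such that $S\subseteq \operatorname{pa}_{\mathcal{G}}(i)\cup\{i\}$, and $c_{\mathcal{G}}(S)=0$ otherwise. The skeleton of a DAG is its underlying undirected graph. A DAG $\mathcal{G}$ with skeleton $G$ respects $\sigma=(v_1,\dots,v_n)$ if $v_iv_j\in G$ with $i<j$ implies $v_i\to v_j\in\mathcal{G}$. Containment of graphs on $[n]$ means containment of edge sets. A polytope $P$ with vertex set $V$ fulfills the rhombus criterion if for every pair of distinct vertices $\alpha,\beta\in V$, either $\operatorname{conv}(\alpha,\beta)$ is an edge (1-dimensional face) of $P$, or there exist $\alpha',\beta'\in V\setminus\{\alpha,\beta\}$ with $\alpha+\beta=\alpha'+\beta'$. *)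

theory Defs
  imports "HOL-Analysis.Analysis"
begin

(* The vertex set [n] is UNIV :: 'n set for a finite type 'n, with n = CARD('n).
   A directed graph is its set of arcs, (j, i) standing for j --> i, so that a DAG is
   a relation satisfying the library predicate acyclic. An undirected graph is its set of
   edges, each a two-element set of vertices. *)

definition parents :: "('n \<times> 'n) set \<Rightarrow> 'n \<Rightarrow> 'n set"
  where "parents G i = {j. (j, i) \<in> G}"

definition skeleton :: "('n \<times> 'n) set \<Rightarrow> 'n set set"
  where "skeleton G = {{u, v} | u v. (u, v) \<in> G}"

definition undirected_graph :: "'n set set \<Rightarrow> bool"
  where "undirected_graph E \<longleftrightarrow> (\<forall>e\<in>E. card e = 2)"

(* The ambient space R^{S : |S| >= 2} is embedded in real ^ 'n set as the coordinate
   subspace on which all coordinates S with |S| < 2 vanish. (The index set is empty for n = 1,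
   so it cannot itself be a type.) Sums, convex hulls, faces and dimensions are unaffected. *)

definition char_imset :: "('n::finite \<times> 'n) set \<Rightarrow> real ^ 'n set"
  where "char_imset G =
    (\<chi> S. if 2 \<le> card S \<and> (\<exists>i\<in>S. S \<subseteq> parents G i \<union> {i}) then 1 else 0)"

(* An order (v_1, ..., v_n) is a bijection s from {1..n} onto the vertices, v_i = s i. *)

definition vertex_order :: "(nat \<Rightarrow> 'n::finite) \<Rightarrow> bool"
  where "vertex_order s \<longleftrightarrow> bij_betw s {1..CARD('n)} UNIV"

definition respects_order :: "(nat \<Rightarrow> 'n::finite) \<Rightarrow> ('n \<times> 'n) set \<Rightarrow> bool"
  where "respects_order s G \<longleftrightarrow>
    (\<forall>i\<in>{1..CARD('n)}. \<forall>j\<in>{1..CARD('n)}.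
      i < j \<longrightarrow> {s i, s j} \<in> skeleton G \<longrightarrow> (s i, s j) \<in> G)"

definition fixed_order_imset_polytope ::
    "(nat \<Rightarrow> 'n::finite) \<Rightarrow> 'n set set \<Rightarrow> 'n set set \<Rightarrow> (real ^ 'n set) set"
  where "fixed_order_imset_polytope s D H =
    convex hull {char_imset G | G.
      acyclic G \<and> respects_order s G \<and> D \<subseteq> skeleton G \<and> skeleton G \<subseteq> H}"

lemma polytope_fixed_order_imset_polytope: "polytope (fixed_order_imset_polytope s D H)"
  unfolding fixed_order_imset_polytope_def by (intro polytope_convex_hull) simp

(* Intended for polytopes P. The vertices of P are its extreme points. *)

definition rhombus_criterion :: "'a::euclidean_space set \<Rightarrow> bool"
  where "rhombus_criterion P \<longleftrightarrow>
    (let V = {x. x extreme_point_of P} in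
      \<forall>a\<in>V. \<forall>b\<in>V. a \<noteq> b \<longrightarrow>
        (convex hull {a, b}) edge_of P \<or>
        (\<exists>a'\<in>V - {a, b}. \<exists>b'\<in>V - {a, b}. a + b = a' + b'))"

end

theory Submission
  imports Defs
begin

text \<open>A DAG that respects the order and has its skeleton between \<open>D\<close> and \<open>H\<close> amounts to a free
  choice, for each vertex \<open>v\<close>, of a parent set between two fixed sets of predecessors of \<open>v\<close>, and
  the coordinates \<open>S\<close> of the imset whose last vertex is \<open>v\<close> depend only on that choice. By Moebius
  inversion every real function of the parent set of \<open>v\<close> is affine in these coordinates, so the
  polytope is a product of simplices. Hence two DAGs that differ at a single vertex span an edge,
  and two DAGs that differ at \<open>v\<close> and also elsewhere form a rhombus with the DAGs obtained by
  exchanging their parent sets at \<open>v\<close>.\<close>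

section \<open>Moebius inversion on subsets and faces of convex hulls\<close>

lemma Moebius_coefficients_exist:
  fixes f :: "'a::finite set \<Rightarrow> 'b::ab_group_add"
  obtains c where "\<And>P. f P = (\<Sum>T\<in>Pow P. c T)"
proof -
  \<comment> \<open>The desired identity, solved for its top term \<open>c P\<close>, is a recursion
    over proper subsets. It takes the place of the explicit alternating sum.\<close>
  define c where "c = wfrec finite_psubset (\<lambda>c P. f P - (\<Sum>T | T \<subset> P. c T))"
  have c: "c P = f P - (\<Sum>T | T \<subset> P. c T)" for P
    unfolding c_def
    by (subst wfrec[OF wf_finite_psubset])
      (auto simp: cut_def finite_psubset_def intro!: sum.cong)
  have "f P = (\<Sum>T\<in>Pow P. c T)" for P
  proof -
    have "Pow P = insert P {T. T \<subset> P}" by auto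
    then show ?thesis using c[of P] by simp
  qed
  then show thesis by (rule that)
qed

text \<open>The supporting hyperplane \<open>w \<bullet> x = k\<close> cuts out a face of the hull,
  and such a face is the hull of those points of \<open>V\<close> that lie on it, here exactly
  \<open>B\<close>.\<close>

lemma face_of_convex_hull_argmin:
  fixes V :: "'a::euclidean_space set"
  assumes "finite V" "B \<subseteq> V"
    and ge: "\<And>x. x \<in> V \<Longrightarrow> k \<le> w \<bullet> x"
    and eq: "\<And>x. x \<in> V \<Longrightarrow> w \<bullet> x = k \<longleftrightarrow> x \<in> B"
  shows "(convex hull B) face_of (convex hull V)"
proof -
  let ?F = "convex hull V \<inter> {x. w \<bullet> x = k}"
  have "convex hull V \<subseteq> {x. k \<le> w \<bullet> x}"
    using ge by (intro hull_minimal) (auto simp: convex_halfspace_ge)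
  then have face: "?F face_of convex hull V"
    by (intro face_of_Int_supporting_hyperplane_ge) auto
  then obtain W where W: "W \<subseteq> V" "?F = convex hull W"
    using face_of_convex_hull_subset[OF finite_imp_compact[OF \<open>finite V\<close>]] by metis
  have "W \<subseteq> {x. w \<bullet> x = k}"
    using hull_subset[of W convex] W(2) by blast
  then have "W \<subseteq> B" using W(1) eq by auto
  then have "?F \<subseteq> convex hull B" unfolding W(2) by (rule hull_mono)
  moreover have "convex hull B \<subseteq> {x. w \<bullet> x = k}"
    using assms(2) eq by (intro hull_minimal) (auto simp: convex_hyperplane)
  then have "convex hull B \<subseteq> ?F" using hull_mono[OF assms(2)] by blast
  ultimately show ?thesis using face by (metis antisym)
qed

lemma edge_of_convex_hull_2:
  fixes a b :: "'a::euclidean_space"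
  assumes "(convex hull {a, b}) face_of P" "a \<noteq> b"
  shows "(convex hull {a, b}) edge_of P"
  using assms by (simp add: edge_of_def aff_dim_convex_hull)

section \<open>DAGs between the two graphs as independent choices of parent sets\<close>

definition predecessors :: "(nat \<Rightarrow> 'n::finite) \<Rightarrow> 'n \<Rightarrow> 'n set"
  where "predecessors s v = {s i | i j. 1 \<le> i \<and> i < j \<and> j \<le> CARD('n) \<and> v = s j}"

definition earlier_neighbours :: "(nat \<Rightarrow> 'n::finite) \<Rightarrow> 'n set set \<Rightarrow> 'n \<Rightarrow> 'n set"
  where "earlier_neighbours s E v = {u \<in> predecessors s v. {u, v} \<in> E}"

text \<open>This condition constrains each vertex separately, whereas acyclicity is a global
  condition. Parent sets can therefore be chosen and exchanged vertex by vertex.\<close>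

definition admissible :: "(nat \<Rightarrow> 'n::finite) \<Rightarrow> 'n set set \<Rightarrow> 'n set set \<Rightarrow> ('n \<times> 'n) set \<Rightarrow> bool"
  where "admissible s D H G \<longleftrightarrow>
    (\<forall>v. earlier_neighbours s D v \<subseteq> parents G v \<and> parents G v \<subseteq> earlier_neighbours s H v)"

locale ordered_vertices =
  fixes s :: "nat \<Rightarrow> 'n::finite"
  assumes order: "vertex_order s"
begin

definition pos :: "'n \<Rightarrow> nat"
  where "pos = the_inv_into {1..CARD('n)} s"

lemma s_pos [simp]: "s (pos v) = v"
  using order unfolding vertex_order_def pos_def bij_betw_def
  by (intro f_the_inv_into_f) auto

lemma pos_s: "i \<in> {1..CARD('n)} \<Longrightarrow> pos (s i) = i"
  using order unfolding vertex_order_def pos_def bij_betw_def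
  by (intro the_inv_into_f_f) auto

lemma pos_in: "pos v \<in> {1..CARD('n)}"
  using order unfolding vertex_order_def pos_def bij_betw_def
  by (intro the_inv_into_into) auto

lemma pos_inject: "pos u = pos v \<longleftrightarrow> u = v"
  by (metis s_pos)

lemma predecessors_iff: "u \<in> predecessors s v \<longleftrightarrow> pos u < pos v"
proof
  assume "u \<in> predecessors s v"
  then obtain i j where ij: "1 \<le> i" "i < j" "j \<le> CARD('n)" "u = s i" "v = s j"
    by (auto simp: predecessors_def)
  then show "pos u < pos v" using pos_s[of i] pos_s[of j] by simp
next
  assume "pos u < pos v"
  then show "u \<in> predecessors s v"
    using pos_in[of u] pos_in[of v] unfolding predecessors_def
    by (intro CollectI exI[of _ "pos u"] exI[of _ "pos v"]) simp
qed

lemma respects_order_iff: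
  "respects_order s G \<longleftrightarrow> (\<forall>u v. pos u < pos v \<longrightarrow> {u, v} \<in> skeleton G \<longrightarrow> (u, v) \<in> G)"
proof
  assume *: "respects_order s G"
  have "(s (pos u), s (pos v)) \<in> G" if "pos u < pos v" "{u, v} \<in> skeleton G" for u v
    using * that pos_in[of u] pos_in[of v] unfolding respects_order_def s_pos
    by (metis s_pos)
  then show "\<forall>u v. pos u < pos v \<longrightarrow> {u, v} \<in> skeleton G \<longrightarrow> (u, v) \<in> G" by simp
qed (simp add: respects_order_def pos_s)

text \<open>An arc against the order would be accompanied by its reverse, giving a cycle of length
  two. Conversely, if all arcs go forward, then \<open>pos\<close> increases along each of them,
  which excludes cycles.\<close>

lemma acyclic_respects_order_iff:
  "acyclic G \<and> respects_order s G \<longleftrightarrow> (\<forall>v. parents G v \<subseteq> predecessors s v)"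
proof safe
  fix u v
  assume G: "acyclic G" "respects_order s G" and "u \<in> parents G v"
  then have uv: "(u, v) \<in> G" by (simp add: parents_def)
  have "u \<noteq> v" using uv G(1) by (auto simp: acyclic_def)
  moreover have "\<not> pos v < pos u"
  proof
    assume "pos v < pos u"
    moreover have "{v, u} \<in> skeleton G" using uv by (auto simp: skeleton_def)
    ultimately have "(v, u) \<in> G" using G(2) by (auto simp: respects_order_iff)
    then have "(u, u) \<in> G\<^sup>+" using uv by auto
    then show False using G(1) by (auto simp: acyclic_def)
  qed
  ultimately show "u \<in> predecessors s v"
    using pos_inject[of u v] by (simp add: predecessors_iff)
next
  assume "\<forall>v. parents G v \<subseteq> predecessors s v"
  then have less: "pos u < pos v" if "(u, v) \<in> G" for u v
    using that predecessors_iff[of u v] by (auto simp: parents_def)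
  then have "G \<subseteq> Wellfounded.measure pos" by (auto simp: in_measure)
  then show "acyclic G" by (rule acyclic_subset[OF wf_acyclic[OF wf_measure]])
  show "respects_order s G"
    unfolding respects_order_iff
  proof (intro allI impI)
    fix u v assume "pos u < pos v" "{u, v} \<in> skeleton G"
    then show "(u, v) \<in> G"
      using less[of v u] by (auto simp: skeleton_def doubleton_eq_iff)
  qed
qed

lemma skeleton_iff:
  assumes "\<And>v. parents G v \<subseteq> predecessors s v" "pos u < pos v"
  shows "{u, v} \<in> skeleton G \<longleftrightarrow> u \<in> parents G v"
proof -
  have "(v, u) \<notin> G"
    using assms(1)[of u] assms(2) predecessors_iff[of v u] by (auto simp: parents_def)
  then show ?thesis by (auto simp: skeleton_def doubleton_eq_iff parents_def)
qed

lemma undirected_edgeE: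
  assumes "undirected_graph E" "e \<in> E"
  obtains u v where "e = {u, v}" "pos u < pos v"
proof -
  from assms obtain u v where "e = {u, v}" "u \<noteq> v"
    by (auto simp: undirected_graph_def card_2_iff)
  then show thesis
    using that[of u v] that[of v u] pos_inject[of u v]
    by (metis insert_commute linorder_neqE_nat)
qed

lemma admissible_iff:
  assumes "undirected_graph D"
  shows "admissible s D H G \<longleftrightarrow>
    acyclic G \<and> respects_order s G \<and> D \<subseteq> skeleton G \<and> skeleton G \<subseteq> H"
proof -
  have "admissible s D H G \<longleftrightarrow> D \<subseteq> skeleton G \<and> skeleton G \<subseteq> H"
    if pred: "\<And>v. parents G v \<subseteq> predecessors s v"
  proof -
    have "D \<subseteq> skeleton G \<longleftrightarrow> (\<forall>v. earlier_neighbours s D v \<subseteq> parents G v)"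
    proof safe
      fix u v assume "D \<subseteq> skeleton G" "u \<in> earlier_neighbours s D v"
      then show "u \<in> parents G v"
        using skeleton_iff[OF pred, of u v] by (auto simp: earlier_neighbours_def predecessors_iff)
    next
      fix e assume *: "\<forall>v. earlier_neighbours s D v \<subseteq> parents G v" and "e \<in> D"
      \<comment> \<open>As a pair of distinct vertices, an edge of \<open>D\<close> has a later end
        \<open>v\<close>, and the lower bound on the parents of \<open>v\<close> forces the edge
        into the skeleton.\<close>
      then obtain u v where "e = {u, v}" "pos u < pos v" "{u, v} \<in> D"
        using undirected_edgeE[OF assms] by metis
      then show "e \<in> skeleton G"
        using * skeleton_iff[OF pred, of u v] by (auto simp: earlier_neighbours_def predecessors_iff)
    qed
    moreover have "skeleton G \<subseteq> H \<longleftrightarrow> (\<forall>v. parents G v \<subseteq> earlier_neighbours s H v)"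
      using pred by (fastforce simp: skeleton_def earlier_neighbours_def parents_def)
    ultimately show ?thesis by (auto simp: admissible_def)
  qed
  moreover have "parents G v \<subseteq> predecessors s v" if "admissible s D H G" for v
    using that by (auto simp: admissible_def earlier_neighbours_def)
  ultimately show ?thesis using acyclic_respects_order_iff[of G] by metis
qed

section \<open>Coordinates of the imset and the faces they define\<close>

lemma char_imset_nth_insert:
  assumes pred: "\<And>v. parents G v \<subseteq> predecessors s v"
    and T: "T \<subseteq> predecessors s v" "T \<noteq> {}"
  shows "char_imset G $ insert v T = of_bool (T \<subseteq> parents G v)"
proof -
  have v: "v \<notin> T" using T by (auto simp: predecessors_iff)
  then have "2 \<le> card (insert v T)"
    using T(2) by (simp add: Suc_le_eq card_gt_0_iff)
  moreover have "(\<exists>i\<in>insert v T. insert v T \<subseteq> parents G i \<union> {i}) \<longleftrightarrow> T \<subseteq> parents G v"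
  proof
    assume "\<exists>i\<in>insert v T. insert v T \<subseteq> parents G i \<union> {i}"
    then obtain i where i: "i \<in> insert v T" "insert v T \<subseteq> parents G i \<union> {i}" by auto
    \<comment> \<open>Only the last vertex of the set can have all the others as parents: if
      \<open>i\<close> were another one, then \<open>v\<close> and \<open>i\<close> would precede
      each other.\<close>
    have "i = v"
    proof (rule ccontr)
      assume "i \<noteq> v"
      then have "v \<in> predecessors s i" "i \<in> predecessors s v"
        using i T pred[of i] by auto
      then show False by (simp add: predecessors_iff)
    qed
    then show "T \<subseteq> parents G v" using i v by auto
  qed auto
  ultimately show ?thesis by (simp add: char_imset_def)
qed

text \<open>Splitting off the last vertex of \<open>S\<close> brings every coordinate that can be
  nonzero into the form evaluated by \<open>char_imset_nth_insert\<close>.\<close>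

lemma set_eq_insert_last:
  assumes "2 \<le> card S"
  obtains v T where "S = insert v T" "T \<subseteq> predecessors s v" "T \<noteq> {}"
proof -
  have "S \<noteq> {}" using assms by auto
  then have "Max (pos ` S) \<in> pos ` S" by simp
  then obtain v where "v \<in> S" "pos v = Max (pos ` S)" by auto
  then have v: "v \<in> S" "\<And>u. u \<in> S \<Longrightarrow> pos u \<le> pos v" by auto
  show thesis
  proof
    show "S = insert v (S - {v})" using v by auto
    show "S - {v} \<subseteq> predecessors s v"
      using v pos_inject by (force simp: predecessors_iff order.strict_iff_order)
    show "S - {v} \<noteq> {}"
    proof
      assume "S - {v} = {}"
      then have "S = {v}" using v by auto
      then show False using assms by simp
    qed
  qed
qed

text \<open>The coordinates at two-element sets already record all arcs.\<close>

lemma char_imset_eq_iff: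
  assumes "\<And>v. parents G v \<subseteq> predecessors s v" "\<And>v. parents G' v \<subseteq> predecessors s v"
  shows "char_imset G = char_imset G' \<longleftrightarrow> (\<forall>v. parents G v = parents G' v)"
proof
  assume eq: "char_imset G = char_imset G'"
  have "u \<in> parents G v \<longleftrightarrow> u \<in> parents G' v" if "u \<in> predecessors s v" for u v
    using char_imset_nth_insert[OF assms(1), of "{u}" v]
      char_imset_nth_insert[OF assms(2), of "{u}" v] that eq
    by (simp add: of_bool_eq_iff)
  then show "\<forall>v. parents G v = parents G' v" using assms by blast
qed (simp add: char_imset_def)

text \<open>Moebius inversion writes each \<open>f v\<close> as a combination of indicators of
  \<open>T \<subseteq> parents G v\<close>, and for nonempty \<open>T\<close> these are coordinates
  of the imset. Thus arbitrary costs on the parent sets, added over the vertices, give an affine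
  function of the imset.\<close>

lemma parents_sum_eq_inner_char_imset:
  fixes f :: "'n \<Rightarrow> 'n set \<Rightarrow> real"
  obtains w k where
    "\<And>G. (\<And>v. parents G v \<subseteq> predecessors s v) \<Longrightarrow>
      (\<Sum>v\<in>UNIV. f v (parents G v)) = w \<bullet> char_imset G - k"
proof -
  have "\<exists>c. \<forall>P. f v P = (\<Sum>T\<in>Pow P. c T)" for v
    using Moebius_coefficients_exist[of "f v"] by metis
  then obtain c where c: "\<And>v P. f v P = (\<Sum>T\<in>Pow P. c v T)" by metis
  define w where "w = (\<Sum>v\<in>UNIV. \<Sum>T\<in>Pow (predecessors s v) - {{}}.
    c v T *\<^sub>R axis (insert v T) (1::real))"
  show thesis
  proof
    fix G assume pred: "\<And>v. parents G v \<subseteq> predecessors s v"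
    have "f v (parents G v) =
      c v {} + (\<Sum>T\<in>Pow (predecessors s v) - {{}}. c v T * char_imset G $ insert v T)" for v
    proof -
      have "f v (parents G v) = c v {} + (\<Sum>T\<in>Pow (parents G v) - {{}}. c v T)"
        unfolding c by (subst sum.remove[of _ "{}"]) auto
      also have "(\<Sum>T\<in>Pow (parents G v) - {{}}. c v T) =
        (\<Sum>T\<in>Pow (predecessors s v) - {{}}. c v T * char_imset G $ insert v T)"
      proof (rule sum.mono_neutral_cong_left)
        show "Pow (parents G v) - {{}} \<subseteq> Pow (predecessors s v) - {{}}"
          using pred[of v] by auto
        show "\<forall>T\<in>Pow (predecessors s v) - {{}} - (Pow (parents G v) - {{}}).
            c v T * char_imset G $ insert v T = 0"
          by (auto simp: char_imset_nth_insert[OF pred])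
        show "c v T = c v T * char_imset G $ insert v T" if "T \<in> Pow (parents G v) - {{}}" for T
          using that pred[of v] by (subst char_imset_nth_insert[OF pred]) auto
      qed simp
      finally show ?thesis .
    qed
    \<comment> \<open>The empty set is contained in every parent set but yields no coordinate, so
      its coefficients make up the constant.\<close>
    then show "(\<Sum>v\<in>UNIV. f v (parents G v)) = w \<bullet> char_imset G - (- (\<Sum>v\<in>UNIV. c v {}))"
      by (simp add: w_def inner_sum_left sum.distrib inner_axis')
  qed
qed

text \<open>The functional counts the vertices whose parent set agrees with neither
  \<open>G1\<close> nor \<open>G2\<close>; among the given imsets it attains its minimum exactly at
  these two. The two graphs may coincide, and then the face is a single point.\<close>

lemma face_of_differ_at_one_vertex:
  assumes pred: "\<And>G v. G \<in> \<G> \<Longrightarrow> parents G v \<subseteq> predecessors s v"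
    and G: "G1 \<in> \<G>" "G2 \<in> \<G>"
    and eq: "\<And>v. v \<noteq> v0 \<Longrightarrow> parents G1 v = parents G2 v"
  shows "(convex hull {char_imset G1, char_imset G2}) face_of (convex hull (char_imset ` \<G>))"
proof -
  define f :: "'n \<Rightarrow> 'n set \<Rightarrow> real"
    where "f v P = of_bool (P \<notin> {parents G1 v, parents G2 v})" for v P
  obtain w k where w: "\<And>G. (\<And>v. parents G v \<subseteq> predecessors s v) \<Longrightarrow>
      (\<Sum>v\<in>UNIV. f v (parents G v)) = w \<bullet> char_imset G - k"
    using parents_sum_eq_inner_char_imset[of f] by metis
  show ?thesis
  proof (rule face_of_convex_hull_argmin[where w = w and k = k])
    fix x assume "x \<in> char_imset ` \<G>"
    then obtain G where "G \<in> \<G>" and x: "x = char_imset G" by auto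
    note sum = w[OF pred[OF \<open>G \<in> \<G>\<close>]]
    have "0 \<le> (\<Sum>v\<in>UNIV. f v (parents G v))"
      by (intro sum_nonneg) (simp add: f_def)
    then show "k \<le> w \<bullet> x" using sum x by simp
    have "w \<bullet> x = k \<longleftrightarrow> (\<Sum>v\<in>UNIV. f v (parents G v)) = 0"
      using sum x by auto
    also have "\<dots> \<longleftrightarrow> (\<forall>v. parents G v \<in> {parents G1 v, parents G2 v})"
      by (subst sum_nonneg_eq_0_iff) (auto simp: f_def)
    \<comment> \<open>Away from \<open>v0\<close> both options are the same set, so the choice at
      \<open>v0\<close> decides which of the two graphs is met.\<close>
    also have "\<dots> \<longleftrightarrow> (\<forall>v. parents G v = parents G1 v) \<or> (\<forall>v. parents G v = parents G2 v)"
      using eq by (metis insertE insertI1 insertI2 singletonD)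
    also have "\<dots> \<longleftrightarrow> x \<in> {char_imset G1, char_imset G2}"
      using x char_imset_eq_iff[OF pred[OF \<open>G \<in> \<G>\<close>] pred[OF G(1)]]
        char_imset_eq_iff[OF pred[OF \<open>G \<in> \<G>\<close>] pred[OF G(2)]] by auto
    finally show "w \<bullet> x = k \<longleftrightarrow> x \<in> {char_imset G1, char_imset G2}" .
  qed (use G in auto)
qed

end

section \<open>Rhombi from exchanging the parent sets at one vertex\<close>

definition exchange_parents :: "'n \<Rightarrow> ('n \<times> 'n) set \<Rightarrow> ('n \<times> 'n) set \<Rightarrow> ('n \<times> 'n) set"
  where "exchange_parents v0 G G' = {(u, v). (u, v) \<in> (if v = v0 then G' else G)}"

lemma parents_exchange_parents:
  "parents (exchange_parents v0 G G') v = (if v = v0 then parents G' v else parents G v)"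
  by (simp add: exchange_parents_def parents_def)

text \<open>Each coordinate depends on the parent set of one vertex only. The exchange therefore
  either swaps the two summands of that coordinate or leaves them alone.\<close>

lemma (in ordered_vertices) char_imset_exchange_parents_sum:
  assumes pred: "\<And>v. parents G v \<subseteq> predecessors s v" "\<And>v. parents G' v \<subseteq> predecessors s v"
  shows "char_imset (exchange_parents v0 G G') + char_imset (exchange_parents v0 G' G) =
    char_imset G + char_imset G'"
proof (rule vec_eq_iff[THEN iffD2], rule allI)
  fix S :: "'n set"
  have ex: "parents (exchange_parents v0 G G') v \<subseteq> predecessors s v"
    "parents (exchange_parents v0 G' G) v \<subseteq> predecessors s v" for v
    using pred by (auto simp: parents_exchange_parents)
  show "(char_imset (exchange_parents v0 G G') + char_imset (exchange_parents v0 G' G)) $ S =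
    (char_imset G + char_imset G') $ S"
  proof (cases "2 \<le> card S")
    case True
    then obtain v T where "S = insert v T" "T \<subseteq> predecessors s v" "T \<noteq> {}"
      by (rule set_eq_insert_last)
    then show ?thesis
      by (simp add: char_imset_nth_insert pred ex parents_exchange_parents)
  qed (simp add: char_imset_def)
qed

theorem proposition3p3:
  fixes \<sigma> :: "nat \<Rightarrow> 'n::finite" and D H :: "'n set set"
  assumes "vertex_order \<sigma>"
    and "undirected_graph D" and "undirected_graph H" and "D \<subseteq> H"
  shows "rhombus_criterion (fixed_order_imset_polytope \<sigma> D H)"
proof -
  interpret ordered_vertices \<sigma> by unfold_locales (fact assms(1))
  define \<G> where "\<G> = {G. admissible \<sigma> D H G}"
  let ?P = "convex hull (char_imset ` \<G>)"
  have P: "fixed_order_imset_polytope \<sigma> D H = ?P"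
    unfolding fixed_order_imset_polytope_def \<G>_def admissible_iff[OF assms(2)]
    by (simp add: setcompr_eq_image)
  have pred: "parents G v \<subseteq> predecessors \<sigma> v" if "G \<in> \<G>" for G v
    using that by (auto simp: \<G>_def admissible_def earlier_neighbours_def)
  have extreme: "x extreme_point_of ?P \<longleftrightarrow> x \<in> char_imset ` \<G>" for x
  proof
    assume "x \<in> char_imset ` \<G>"
    then obtain G where "G \<in> \<G>" "x = char_imset G" by auto
    \<comment> \<open>Taking both graphs equal to \<open>G\<close> turns the face into a single
      vertex.\<close>
    then show "x extreme_point_of ?P"
      using face_of_differ_at_one_vertex[OF pred \<open>G \<in> \<G>\<close> \<open>G \<in> \<G>\<close> refl]
      by (simp add: face_of_singleton)
  qed (rule extreme_point_of_convex_hull)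
  show ?thesis
    unfolding rhombus_criterion_def P extreme Let_def Collect_mem_eq
  proof (intro ballI impI)
    fix a b assume "a \<in> char_imset ` \<G>" "b \<in> char_imset ` \<G>" and "a \<noteq> b"
    then obtain G1 G2 where G: "G1 \<in> \<G>" "G2 \<in> \<G>" and ab: "a = char_imset G1" "b = char_imset G2"
      by auto
    obtain v0 where v0: "parents G1 v0 \<noteq> parents G2 v0"
      using \<open>a \<noteq> b\<close> ab char_imset_eq_iff[OF pred[OF G(1)] pred[OF G(2)]] by auto
    show "(convex hull {a, b}) edge_of ?P \<or> (\<exists>a'\<in>char_imset ` \<G> - {a, b}.
      \<exists>b'\<in>char_imset ` \<G> - {a, b}. a + b = a' + b')"
    proof (cases "\<exists>v1. v1 \<noteq> v0 \<and> parents G1 v1 \<noteq> parents G2 v1")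
      case False
      then have "(convex hull {a, b}) face_of ?P"
        unfolding ab by (intro face_of_differ_at_one_vertex[OF pred G]) auto
      then show ?thesis using edge_of_convex_hull_2 \<open>a \<noteq> b\<close> by blast
    next
      case True
      then obtain v1 where v1: "v1 \<noteq> v0" "parents G1 v1 \<noteq> parents G2 v1" by auto
      let ?G1 = "exchange_parents v0 G1 G2" and ?G2 = "exchange_parents v0 G2 G1"
      \<comment> \<open>The bounds hold at each vertex separately, so they survive the
        exchange.\<close>
      have ex: "?G1 \<in> \<G>" "?G2 \<in> \<G>"
        using G by (auto simp: \<G>_def admissible_def parents_exchange_parents)
      have neq: "char_imset F \<noteq> char_imset G"
        if "F \<in> \<G>" "G \<in> \<G>" "parents F v \<noteq> parents G v" for F G v
        using that char_imset_eq_iff[OF pred pred] by blast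
      \<comment> \<open>\<open>?G1\<close> differs from \<open>G1\<close> at \<open>v0\<close> and
        from \<open>G2\<close> at \<open>v1\<close>; for \<open>?G2\<close> the roles of
        \<open>v0\<close> and \<open>v1\<close> are reversed.\<close>
      have "char_imset ?G1 \<notin> {a, b}" "char_imset ?G2 \<notin> {a, b}"
        using neq[OF ex(1) G(1), of v0] neq[OF ex(1) G(2), of v1]
          neq[OF ex(2) G(1), of v1] neq[OF ex(2) G(2), of v0] v0 v1
        by (auto simp: ab parents_exchange_parents)
      then show ?thesis
        using ex char_imset_exchange_parents_sum[OF pred[OF G(1)] pred[OF G(2)], of v0]
        unfolding ab by (metis DiffI imageI)
    qed
  qed
qed

end
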